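(* Let $q(\mu)$ be a random utility model with absolutely continuous distribution $\theta$, and let $$w(\mu)=\mathbb E_{\epsilon\sim\theta}\Big[\max_{i\in\mathcal N}(\mu_i+\epsilon_i)\Big]$$ be the corresponding expected utility an individual can get under this model. Then $w(\mu)$ is a differentiable choice welfare function, and $q(\mu)=\nabla w(\mu)$. Moreover, the reverse statement is not true, i.e., there exists a differentiable choice welfare function $w(\mu)$ such that there is no random utility model that gives the choice probability $q(\mu)=\nabla w(\mu)$.
   Context: $\mathcal N=\{1,\dots,n\}$ is the set of alternatives; $\mu=(\mu_1,\dots,\mu_n)\in\mathbb R^n$ is the vector of deterministic utilities; $\mathbf e$ is the all-ones vector; vector inequalities are componentwise; $\overline{\mathbb R}=\mathbb R\cup\{-\infty,+\infty\}$. Random utility model: the utility of alternative $i$ is $\mu_i+\epsilon_i$, where $\epsilon=(\epsilon_1,\dots,\epsilon_n)$ is random with a known, absolutely continuous joint distribution $\theta$. The choice probabilities are $q_i(\mu)=\mathbb P_{\epsilon\sim\theta}\big(i=\arg\max_{k\in\mathcal N}(\mu_k+\epsilon_k)\big)$ for $i\in\mathcal N$, and $q(\mu)=(q_1(\mu),\dots,q_n(\mu))$. Choice welfare function: a mapping $w:\mathbb R^n\to\overline{\mathbb R}$ satisfying (1) monotonicity: for any $\mu^1,\mu^2\in\mathbb R^n$ with $\mu^1\ge\mu^2$, $w(\mu^1)\ge w(\mu^2)$; (2) translation invariance: for any $\mu\in\mathbb R^n$ and $t\in\mathbb R$, $w(\mu+t\mathbf e)=w(\mu)+t$; (3) convexity: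 for any $\mu^1,\mu^2\in\mathbb R^n$ and $0\le\lambda\le1$, $\lambda w(\mu^1)+(1-\lambda)w(\mu^2)\ge w(\lambda\mu^1+(1-\lambda)\mu^2)$. If in addition $w$ is differentiable, it is called a differentiable choice welfare function.
   Formalization: The first part assumes that the maximum of the utilities has a finite expectation for every μ (it fails, for example, for half-Cauchy noise, where w is identically +∞); the failure of the converse is stated for n ≥ 2, since it does not hold for n = 1. *)

theory Defs
  imports "HOL-Probability.Probability"
begin

text \<open>
  The set of alternatives is a finite index type \<open>'n\<close>, so \<open>n = CARD('n)\<close>; \<open>\<theta>\<close> is the law of the
  noise vector on \<open>real ^ 'n\<close>. The order on \<open>real ^ 'n\<close> is componentwise and \<open>1 :: real ^ 'n\<close> is
  the all-ones vector.
\<close>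

definition random_utility_model :: "(real ^ 'n) measure \<Rightarrow> bool" where
  "random_utility_model \<theta> \<longleftrightarrow>
     prob_space \<theta> \<and> sets \<theta> = sets borel \<and> absolutely_continuous lborel \<theta>"

text \<open>
  ``\<open>i = argmax\<close>'' is read as: \<open>i\<close> is the only maximiser. Ties have probability zero for an
  absolutely continuous law.
\<close>

definition choice_prob :: "(real ^ 'n) measure \<Rightarrow> real ^ 'n \<Rightarrow> real ^ 'n" where
  "choice_prob \<theta> \<mu> =
     (\<chi> i. measure \<theta> {\<epsilon> \<in> space \<theta>. {k. is_arg_max (\<lambda>k. \<mu> $ k + \<epsilon> $ k) (\<lambda>_. True) k} = {i}})"

text \<open>
  The Bochner integral is \<open>0\<close> for a non-integrable function, so this is the expectation only when the
  maximum is integrable.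
\<close>

definition expected_max_utility :: "(real ^ 'n) measure \<Rightarrow> real ^ 'n \<Rightarrow> ereal" where
  "expected_max_utility \<theta> \<mu> = ereal (\<integral>\<epsilon>. (MAX i. \<mu> $ i + \<epsilon> $ i) \<partial>\<theta>)"

text \<open>
  In \<open>ereal\<close>, \<open>\<infinity> + (-\<infinity>) = \<infinity>\<close> and \<open>0 * \<infinity> = 0\<close>, the usual conventions for convexity of an
  extended-real-valued function.
\<close>

definition choice_welfare_function :: "(real ^ 'n \<Rightarrow> ereal) \<Rightarrow> bool" where
  "choice_welfare_function w \<longleftrightarrow>
     (\<forall>\<mu>1 \<mu>2. \<mu>1 \<ge> \<mu>2 \<longrightarrow> w \<mu>1 \<ge> w \<mu>2) \<and>
     (\<forall>\<mu> t. w (\<mu> + t *\<^sub>R 1) = w \<mu> + ereal t) \<and>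
     (\<forall>\<mu>1 \<mu>2 l. 0 \<le> l \<and> l \<le> 1 \<longrightarrow>
        ereal l * w \<mu>1 + ereal (1 - l) * w \<mu>2 \<ge> w (l *\<^sub>R \<mu>1 + (1 - l) *\<^sub>R \<mu>2))"

text \<open>Differentiability everywhere entails finiteness everywhere.\<close>

definition differentiable_choice_welfare_function :: "(real ^ 'n \<Rightarrow> ereal) \<Rightarrow> bool" where
  "differentiable_choice_welfare_function w \<longleftrightarrow>
     choice_welfare_function w \<and>
     (\<forall>\<mu>. \<bar>w \<mu>\<bar> \<noteq> \<infinity>) \<and>
     (\<forall>\<mu>. (\<lambda>x. real_of_ereal (w x)) differentiable (at \<mu>))"

definition has_gradient_field :: "(real ^ 'n \<Rightarrow> ereal) \<Rightarrow> (real ^ 'n \<Rightarrow> real ^ 'n) \<Rightarrow> bool" where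
  "has_gradient_field w q \<longleftrightarrow>
     (\<forall>\<mu>. \<bar>w \<mu>\<bar> \<noteq> \<infinity>) \<and> (\<forall>\<mu>. GDERIV (\<lambda>x. real_of_ereal (w x)) \<mu> :> q \<mu>)"

end

theory Submission
  imports Defs
begin

text \<open>
  For a fixed noise vector \<open>\<epsilon>\<close> the map \<open>\<mu> \<mapsto> max\<^sub>i (\<mu>\<^sub>i + \<epsilon>\<^sub>i)\<close> is monotone, translation invariant,
  convex and 1-Lipschitz, and the first three properties pass to the expectation \<open>w\<close>. Where the
  maximiser \<open>i\<close> is unique, the map agrees near \<open>\<mu>\<close> with \<open>x \<mapsto> x\<^sub>i + \<epsilon>\<^sub>i\<close>, so that its gradient is the
  \<open>i\<close>-th unit vector. Ties lie on finitely many hyperplanes, which are null sets for an absolutely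
  continuous law. The difference quotient of the remainder in the first-order expansion is
  therefore almost surely eventually zero, and it is bounded by 2 by the Lipschitz property; by
  dominated convergence its expectation tends to zero. So \<open>w\<close> is Frechet differentiable and its
  gradient is the expected unit vector of the maximiser, which is the vector of choice
  probabilities (\<open>gderiv_expected_max\<close>).

  For the failure of the converse, the projection \<open>w \<mu> = \<mu>\<^sub>a\<close> is a differentiable choice welfare
  function whose gradient is constantly the \<open>a\<close>-th unit vector. In a random utility model every
  other alternative \<open>b\<close> is chosen with positive probability once its deterministic utility is large
  enough (\<open>choice_prob_pos\<close>), so this gradient is not a vector of choice probabilities.
\<close>

section \<open>The maximum of a finite family\<close>

lemma unique_arg_max_iff:
  fixes f :: "'n::finite \<Rightarrow> 'a::linorder"
  shows "{k. is_arg_max f (\<lambda>_. True) k} = {i} \<longleftrightarrow> (\<forall>k. k \<noteq> i \<longrightarrow> f k < f i)"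
proof
  assume eq: "{k. is_arg_max f (\<lambda>_. True) k} = {i}"
  then have "is_arg_max f (\<lambda>_. True) i"
    by blast
  then have le: "f k \<le> f i" for k
    by (simp add: is_arg_max_linorder)
  show "\<forall>k. k \<noteq> i \<longrightarrow> f k < f i"
  proof (intro allI impI)
    fix k assume "k \<noteq> i"
    with eq have "\<not> is_arg_max f (\<lambda>_. True) k"
      by blast
    then obtain y where "f k < f y"
      by (auto simp: is_arg_max_linorder not_le)
    with le[of y] show "f k < f i"
      by order
  qed
next
  assume "\<forall>k. k \<noteq> i \<longrightarrow> f k < f i"
  then show "{k. is_arg_max f (\<lambda>_. True) k} = {i}"
    by (auto simp: is_arg_max_def)
qed

lemma Max_range_eq:
  fixes f :: "'n::finite \<Rightarrow> 'a::linorder"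
  assumes "\<And>k. f k \<le> f i"
  shows "(MAX k. f k) = f i"
  using assms by (intro Max_eqI) auto

lemma Max_range_le_iff:
  fixes f :: "'n::finite \<Rightarrow> 'a::linorder"
  shows "(MAX k. f k) \<le> c \<longleftrightarrow> (\<forall>k. f k \<le> c)"
  by (subst Max_le_iff) auto

lemma le_Max_range:
  fixes f :: "'n::finite \<Rightarrow> 'a::linorder"
  shows "f i \<le> (MAX k. f k)"
  by (intro Max_ge) auto

lemma Max_range_mono:
  fixes f g :: "'n::finite \<Rightarrow> 'a::linorder"
  assumes "\<And>k. f k \<le> g k"
  shows "(MAX k. f k) \<le> (MAX k. g k)"
  unfolding Max_range_le_iff using assms le_Max_range[of g] by (meson order_trans)

lemma Max_range_add_const:
  fixes f :: "'n::finite \<Rightarrow> real"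
  shows "(MAX k. f k + c) = (MAX k. f k) + c"
proof (rule antisym)
  show "(MAX k. f k + c) \<le> (MAX k. f k) + c"
    unfolding Max_range_le_iff using le_Max_range[of f] by simp
  have "f k \<le> (MAX k. f k + c) - c" for k
    using le_Max_range[of "\<lambda>k. f k + c" k] by linarith
  then have "(MAX k. f k) \<le> (MAX k. f k + c) - c"
    unfolding Max_range_le_iff by blast
  then show "(MAX k. f k) + c \<le> (MAX k. f k + c)"
    by linarith
qed

lemma Max_range_Lipschitz:
  fixes f g :: "'n::finite \<Rightarrow> real"
  assumes "\<And>k. \<bar>f k - g k\<bar> \<le> c"
  shows "\<bar>(MAX k. f k) - (MAX k. g k)\<bar> \<le> c"
proof -
  have "f k \<le> g k + c" "g k \<le> f k + c" for k
    using assms[of k] by linarith+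
  then have "(MAX k. f k) \<le> (MAX k. g k + c)" "(MAX k. g k) \<le> (MAX k. f k + c)"
    by (blast intro: Max_range_mono)+
  then show ?thesis
    unfolding Max_range_add_const by linarith
qed

section \<open>Almost sure uniqueness of the maximiser\<close>

lemma choice_prob_nth:
  "choice_prob \<theta> \<mu> $ i =
     measure \<theta> {\<epsilon> \<in> space \<theta>. \<forall>k. k \<noteq> i \<longrightarrow> \<mu> $ k + \<epsilon> $ k < \<mu> $ i + \<epsilon> $ i}"
  unfolding choice_prob_def by (simp add: unique_arg_max_iff)

lemma sets_unique_maximiser:
  fixes \<theta> :: "(real ^ 'n) measure"
  assumes "sets \<theta> = sets borel"
  shows "{\<epsilon> \<in> space \<theta>. \<forall>k. k \<noteq> i \<longrightarrow> \<mu> $ k + \<epsilon> $ k < \<mu> $ i + \<epsilon> $ i} \<in> sets \<theta>"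
proof -
  have "{\<epsilon> \<in> space \<theta>. \<forall>k. k \<noteq> i \<longrightarrow> \<mu> $ k + \<epsilon> $ k < \<mu> $ i + \<epsilon> $ i}
      = (\<Inter>k \<in> - {i}. {\<epsilon>. \<mu> $ k + \<epsilon> $ k < \<mu> $ i + \<epsilon> $ i})"
    using sets_eq_imp_space_eq[OF assms] by auto
  moreover have "open \<dots>"
    by (intro open_INT ballI open_Collect_less continuous_intros) simp
  ultimately show ?thesis
    unfolding assms by (simp only: borel_open)
qed

lemma AE_no_ties:
  fixes \<theta> :: "(real ^ 'n) measure"
  assumes "absolutely_continuous lborel \<theta>"
  shows "AE \<epsilon> in \<theta>. \<forall>k l. k \<noteq> l \<longrightarrow> \<mu> $ k + \<epsilon> $ k \<noteq> \<mu> $ l + \<epsilon> $ l"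
proof -
  have "AE \<epsilon> in \<theta>. \<mu> $ k + \<epsilon> $ k \<noteq> \<mu> $ l + \<epsilon> $ l" if "k \<noteq> l" for k l
  proof -
    let ?n = "axis k 1 - axis l 1 :: real ^ 'n"
    let ?H = "{\<epsilon> :: real ^ 'n. ?n \<bullet> \<epsilon> = \<mu> $ l - \<mu> $ k}"
    have "?n $ k = 1"
      using that by (simp add: axis_def)
    then have "?n \<noteq> 0"
      by (metis zero_index zero_neq_one)
    then have "negligible ?H"
      by (intro negligible_hyperplane) simp
    moreover have "?H \<in> sets borel"
      by (intro borel_closed closed_hyperplane)
    ultimately have "?H \<in> null_sets lborel"
      by (auto simp: null_sets_def negligible_iff_null_sets)
    then have "?H \<in> null_sets \<theta>"
      using assms by (auto simp: absolutely_continuous_def)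
    then show ?thesis
      by (rule AE_I') (auto simp: inner_diff_left inner_axis' algebra_simps)
  qed
  then have "AE \<epsilon> in \<theta>. k \<noteq> l \<longrightarrow> \<mu> $ k + \<epsilon> $ k \<noteq> \<mu> $ l + \<epsilon> $ l" for k l
    by (cases "k = l") auto
  then show ?thesis
    by (simp add: AE_all_countable)
qed

lemma unique_maximiser_if_no_ties:
  fixes \<mu> \<epsilon> :: "real ^ 'n"
  assumes "\<forall>k l. k \<noteq> l \<longrightarrow> \<mu> $ k + \<epsilon> $ k \<noteq> \<mu> $ l + \<epsilon> $ l"
  obtains i where "\<forall>k. k \<noteq> i \<longrightarrow> \<mu> $ k + \<epsilon> $ k < \<mu> $ i + \<epsilon> $ i"
proof -
  have "(MAX k. \<mu> $ k + \<epsilon> $ k) \<in> range (\<lambda>k. \<mu> $ k + \<epsilon> $ k)"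
    by (intro Max_in) auto
  then obtain i where i: "(MAX k. \<mu> $ k + \<epsilon> $ k) = \<mu> $ i + \<epsilon> $ i"
    by blast
  have "\<mu> $ k + \<epsilon> $ k < \<mu> $ i + \<epsilon> $ i" if "k \<noteq> i" for k
    using le_Max_range[of "\<lambda>k. \<mu> $ k + \<epsilon> $ k" k] assms that unfolding i
    by (simp add: order.strict_iff_order)
  then show ?thesis
    using that by blast
qed

section \<open>Differentiation under the expectation\<close>

lemma eventually_Max_eq_maximiser:
  fixes \<mu> \<epsilon> :: "real ^ 'n"
  assumes "\<forall>k. k \<noteq> i \<longrightarrow> \<mu> $ k + \<epsilon> $ k < \<mu> $ i + \<epsilon> $ i"
  shows "\<forall>\<^sub>F x in nhds \<mu>. (MAX k. x $ k + \<epsilon> $ k) = x $ i + \<epsilon> $ i"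
proof -
  have "\<forall>\<^sub>F x in nhds \<mu>. x $ k + \<epsilon> $ k \<le> x $ i + \<epsilon> $ i" for k
  proof (cases "k = i")
    case False
    have "open {x :: real ^ 'n. x $ k + \<epsilon> $ k < x $ i + \<epsilon> $ i}"
      by (intro open_Collect_less continuous_intros)
    with False assms have "\<forall>\<^sub>F x in nhds \<mu>. x $ k + \<epsilon> $ k < x $ i + \<epsilon> $ i"
      by (auto dest: eventually_nhds_in_open)
    then show ?thesis
      by eventually_elim simp
  qed simp
  then have "\<forall>\<^sub>F x in nhds \<mu>. \<forall>k. x $ k + \<epsilon> $ k \<le> x $ i + \<epsilon> $ i"
    by (simp add: eventually_all_finite)
  then show ?thesis
    by eventually_elim (rule Max_range_eq, blast)
qed

lemma gderiv_expected_max: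
  fixes \<theta> :: "(real ^ 'n) measure"
  assumes rum: "random_utility_model \<theta>"
    and int: "\<And>\<mu> :: real ^ 'n. integrable \<theta> (\<lambda>\<epsilon>. MAX i. \<mu> $ i + \<epsilon> $ i)"
  shows "GDERIV (\<lambda>x. \<integral>\<epsilon>. (MAX i. x $ i + \<epsilon> $ i) \<partial>\<theta>) \<mu> :> choice_prob \<theta> \<mu>"
proof -
  interpret prob_space \<theta>
    using rum by (simp add: random_utility_model_def)
  have sets_eq: "sets \<theta> = sets borel" and ac: "absolutely_continuous lborel \<theta>"
    using rum by (auto simp: random_utility_model_def)
  define M :: "real ^ 'n \<Rightarrow> real ^ 'n \<Rightarrow> real" where "M x \<epsilon> = (MAX i. x $ i + \<epsilon> $ i)" for x \<epsilon>
  define W where "W i = {\<epsilon> \<in> space \<theta>. \<forall>k. k \<noteq> i \<longrightarrow> \<mu> $ k + \<epsilon> $ k < \<mu> $ i + \<epsilon> $ i}" for i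
  \<comment> \<open>The linear part of the expansion of \<open>M\<close> at \<open>\<mu>\<close>; it equals \<open>h $ i\<close> on \<open>W i\<close>.\<close>
  define L :: "real ^ 'n \<Rightarrow> real ^ 'n \<Rightarrow> real"
    where "L h \<epsilon> = (\<Sum>i\<in>UNIV. h $ i * indicator (W i) \<epsilon>)" for h \<epsilon>
  define R :: "real ^ 'n \<Rightarrow> real ^ 'n \<Rightarrow> real"
    where "R h \<epsilon> = \<bar>M (\<mu> + h) \<epsilon> - M \<mu> \<epsilon> - L h \<epsilon>\<bar> / norm h" for h \<epsilon>
  have intM: "integrable \<theta> (M x)" for x
    using int unfolding M_def .
  have W: "W i \<in> sets \<theta>" for i
    unfolding W_def using sets_unique_maximiser[OF sets_eq] .
  have intI: "integrable \<theta> (indicator (W i) :: _ \<Rightarrow> real)" for i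
    using W by (simp add: emeasure_eq_measure)
  have intL: "integrable \<theta> (L h)" for h
    unfolding L_def by (intro Bochner_Integration.integrable_sum integrable_mult_right intI)
  have intR: "integrable \<theta> (R h)" for h
    unfolding R_def using intM intL by auto
  have integral_L: "(\<integral>\<epsilon>. L h \<epsilon> \<partial>\<theta>) = h \<bullet> choice_prob \<theta> \<mu>" for h
  proof -
    have "(\<integral>\<epsilon>. L h \<epsilon> \<partial>\<theta>) = (\<Sum>i\<in>UNIV. \<integral>\<epsilon>. h $ i * indicator (W i) \<epsilon> \<partial>\<theta>)"
      unfolding L_def using intI by (intro Bochner_Integration.integral_sum) auto
    also have "\<dots> = (\<Sum>i\<in>UNIV. h $ i * choice_prob \<theta> \<mu> $ i)"
      using W sets.sets_into_space[OF W]
      by (intro sum.cong) (auto simp: choice_prob_nth W_def[symmetric] Int_absorb2)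
    finally show ?thesis
      by (simp add: inner_vec_def)
  qed
  have L_eq: "L h \<epsilon> = h $ i" if "\<epsilon> \<in> W i" for h \<epsilon> i
  proof -
    have "{k. \<epsilon> \<in> W k} = {i}"
      using that unfolding W_def by (auto dest: less_asym)
    then show ?thesis
      by (simp add: L_def)
  qed
  have unique: "AE \<epsilon> in \<theta>. \<exists>i. \<epsilon> \<in> W i"
    using AE_no_ties[OF ac, of \<mu>] AE_space
    by eventually_elim (auto simp: W_def elim!: unique_maximiser_if_no_ties)
  have R_le: "R h \<epsilon> \<le> 2" if "\<epsilon> \<in> W i" for h \<epsilon> i
  proof -
    have "\<bar>M (\<mu> + h) \<epsilon> - M \<mu> \<epsilon>\<bar> \<le> norm h"
      unfolding M_def by (rule Max_range_Lipschitz) (use component_le_norm_cart in auto)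
    moreover have "\<bar>L h \<epsilon>\<bar> \<le> norm h"
      using L_eq[OF that] component_le_norm_cart by metis
    ultimately have "\<bar>M (\<mu> + h) \<epsilon> - M \<mu> \<epsilon> - L h \<epsilon>\<bar> \<le> 2 * norm h"
      by linarith
    then show ?thesis
      unfolding R_def by (cases "h = 0") (auto simp: divide_simps)
  qed
  have R_lim: "(\<lambda>n. R (H n) \<epsilon>) \<longlonglongrightarrow> 0" if "\<epsilon> \<in> W i" and "H \<longlonglongrightarrow> 0" for \<epsilon> i H
  proof -
    have max: "\<forall>k. k \<noteq> i \<longrightarrow> \<mu> $ k + \<epsilon> $ k < \<mu> $ i + \<epsilon> $ i"
      using that(1) by (simp add: W_def)
    have "(\<lambda>n. \<mu> + H n) \<longlonglongrightarrow> \<mu> + 0"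
      using that(2) by (intro tendsto_intros)
    then have "filterlim (\<lambda>n. \<mu> + H n) (nhds \<mu>) sequentially"
      by simp
    then have "\<forall>\<^sub>F n in sequentially. M (\<mu> + H n) \<epsilon> = (\<mu> + H n) $ i + \<epsilon> $ i"
      unfolding M_def by (rule eventually_compose_filterlim[OF eventually_Max_eq_maximiser[OF max]])
    moreover have "M \<mu> \<epsilon> = \<mu> $ i + \<epsilon> $ i"
      using eventually_nhds_x_imp_x[OF eventually_Max_eq_maximiser[OF max]] by (simp add: M_def)
    ultimately have "\<forall>\<^sub>F n in sequentially. R (H n) \<epsilon> = 0"
      by (auto simp: R_def L_eq[OF that(1)] elim!: eventually_mono)
    then show ?thesis
      by (rule tendsto_eventually)
  qed
  have lim: "((\<lambda>h. \<integral>\<epsilon>. R h \<epsilon> \<partial>\<theta>) \<longlongrightarrow> 0) (at 0)"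
    unfolding tendsto_at_iff_sequentially comp_def
  proof (intro allI impI)
    fix H :: "nat \<Rightarrow> real ^ 'n"
    assume H: "H \<longlonglongrightarrow> 0"
    have "(\<lambda>n. \<integral>\<epsilon>. R (H n) \<epsilon> \<partial>\<theta>) \<longlonglongrightarrow> (\<integral>\<epsilon>. 0 \<partial>\<theta>)"
    proof (rule integral_dominated_convergence[where w = "\<lambda>_. 2"])
      show "AE \<epsilon> in \<theta>. (\<lambda>n. R (H n) \<epsilon>) \<longlonglongrightarrow> 0"
        using unique by eventually_elim (use R_lim H in blast)
      show "AE \<epsilon> in \<theta>. norm (R (H n) \<epsilon>) \<le> 2" for n
        using unique
      proof eventually_elim
        case (elim \<epsilon>)
        then have "R (H n) \<epsilon> \<le> 2"
          using R_le by blast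
        moreover have "0 \<le> R (H n) \<epsilon>"
          by (simp add: R_def)
        ultimately show ?case
          by simp
      qed
    qed (use intR in auto)
    then show "(\<lambda>n. \<integral>\<epsilon>. R (H n) \<epsilon> \<partial>\<theta>) \<longlonglongrightarrow> 0"
      by simp
  qed
  have le: "norm ((\<integral>\<epsilon>. M (\<mu> + h) \<epsilon> \<partial>\<theta>) - (\<integral>\<epsilon>. M \<mu> \<epsilon> \<partial>\<theta>) - h \<bullet> choice_prob \<theta> \<mu>) / norm h
      \<le> (\<integral>\<epsilon>. R h \<epsilon> \<partial>\<theta>)" for h
  proof -
    have "(\<integral>\<epsilon>. M (\<mu> + h) \<epsilon> \<partial>\<theta>) - (\<integral>\<epsilon>. M \<mu> \<epsilon> \<partial>\<theta>) - h \<bullet> choice_prob \<theta> \<mu>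
        = (\<integral>\<epsilon>. M (\<mu> + h) \<epsilon> - M \<mu> \<epsilon> - L h \<epsilon> \<partial>\<theta>)"
      using intM intL by (simp add: integral_L)
    moreover have "norm (\<integral>\<epsilon>. M (\<mu> + h) \<epsilon> - M \<mu> \<epsilon> - L h \<epsilon> \<partial>\<theta>)
        \<le> (\<integral>\<epsilon>. \<bar>M (\<mu> + h) \<epsilon> - M \<mu> \<epsilon> - L h \<epsilon>\<bar> \<partial>\<theta>)"
      using integral_norm_bound[of \<theta> "\<lambda>\<epsilon>. M (\<mu> + h) \<epsilon> - M \<mu> \<epsilon> - L h \<epsilon>"] by simp
    ultimately show ?thesis
      unfolding R_def by (simp add: divide_right_mono)
  qed
  have "((\<lambda>h. norm ((\<integral>\<epsilon>. M (\<mu> + h) \<epsilon> \<partial>\<theta>) - (\<integral>\<epsilon>. M \<mu> \<epsilon> \<partial>\<theta>) - h \<bullet> choice_prob \<theta> \<mu>)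
      / norm h) \<longlongrightarrow> 0) (at 0)"
    by (rule real_tendsto_sandwich[OF _ _ tendsto_const lim]) (use le in auto)
  then show ?thesis
    unfolding gderiv_def has_derivative_at M_def by (simp add: bounded_linear_inner_left)
qed

section \<open>The expected maximum is a choice welfare function\<close>

lemma choice_welfare_expected_max:
  fixes \<theta> :: "(real ^ 'n) measure"
  assumes "prob_space \<theta>"
    and int: "\<And>\<mu> :: real ^ 'n. integrable \<theta> (\<lambda>\<epsilon>. MAX i. \<mu> $ i + \<epsilon> $ i)"
  shows "choice_welfare_function (expected_max_utility \<theta>)"
  unfolding choice_welfare_function_def
proof (intro conjI allI impI)
  interpret prob_space \<theta> by fact
  fix x y :: "real ^ 'n" and t l :: real
  show "expected_max_utility \<theta> y \<le> expected_max_utility \<theta> x" if "y \<le> x"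
  proof -
    have "(MAX i. y $ i + \<epsilon> $ i) \<le> (MAX i. x $ i + \<epsilon> $ i)" for \<epsilon>
      using that by (intro Max_range_mono) (simp add: less_eq_vec_def)
    then show ?thesis
      unfolding expected_max_utility_def by (simp add: integral_mono int)
  qed
  show "expected_max_utility \<theta> (x + t *\<^sub>R 1) = expected_max_utility \<theta> x + ereal t"
  proof -
    have "(MAX i. (x + t *\<^sub>R 1) $ i + \<epsilon> $ i) = (MAX i. x $ i + \<epsilon> $ i) + t" for \<epsilon>
      unfolding Max_range_add_const[symmetric] by (simp add: add_ac)
    then show ?thesis
      unfolding expected_max_utility_def by (simp add: int prob_space)
  qed
  assume l: "0 \<le> l \<and> l \<le> 1"
  have "(MAX i. (l *\<^sub>R x + (1 - l) *\<^sub>R y) $ i + \<epsilon> $ i)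
      \<le> l * (MAX i. x $ i + \<epsilon> $ i) + (1 - l) * (MAX i. y $ i + \<epsilon> $ i)" for \<epsilon>
    unfolding Max_range_le_iff
  proof
    fix k
    have "(l *\<^sub>R x + (1 - l) *\<^sub>R y) $ k + \<epsilon> $ k
        = l * (x $ k + \<epsilon> $ k) + (1 - l) * (y $ k + \<epsilon> $ k)"
      by (simp add: algebra_simps)
    also have "\<dots> \<le> l * (MAX i. x $ i + \<epsilon> $ i) + (1 - l) * (MAX i. y $ i + \<epsilon> $ i)"
      using l le_Max_range[of "\<lambda>i. x $ i + \<epsilon> $ i" k] le_Max_range[of "\<lambda>i. y $ i + \<epsilon> $ i" k]
      by (intro add_mono mult_left_mono) auto
    finally show "(l *\<^sub>R x + (1 - l) *\<^sub>R y) $ k + \<epsilon> $ k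
        \<le> l * (MAX i. x $ i + \<epsilon> $ i) + (1 - l) * (MAX i. y $ i + \<epsilon> $ i)" .
  qed
  then have "(\<integral>\<epsilon>. (MAX i. (l *\<^sub>R x + (1 - l) *\<^sub>R y) $ i + \<epsilon> $ i) \<partial>\<theta>)
      \<le> (\<integral>\<epsilon>. l * (MAX i. x $ i + \<epsilon> $ i) + (1 - l) * (MAX i. y $ i + \<epsilon> $ i) \<partial>\<theta>)"
    by (intro integral_mono Bochner_Integration.integrable_add integrable_mult_right int)
  also have "\<dots> = l * (\<integral>\<epsilon>. (MAX i. x $ i + \<epsilon> $ i) \<partial>\<theta>)
      + (1 - l) * (\<integral>\<epsilon>. (MAX i. y $ i + \<epsilon> $ i) \<partial>\<theta>)"
    using int by simp
  finally show "expected_max_utility \<theta> (l *\<^sub>R x + (1 - l) *\<^sub>R y)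
      \<le> ereal l * expected_max_utility \<theta> x + ereal (1 - l) * expected_max_utility \<theta> y"
    unfolding expected_max_utility_def by simp
qed

section \<open>A choice welfare function without a random utility model\<close>

lemma gderiv_component: "GDERIV (\<lambda>x :: real ^ 'n. x $ a) \<mu> :> axis a 1"
proof -
  have "((\<lambda>x :: real ^ 'n. x $ a) has_derivative (\<lambda>x. x $ a)) (at \<mu>)"
    by (intro bounded_linear_imp_has_derivative bounded_linear_vec_nth)
  then show ?thesis
    by (simp add: gderiv_def inner_axis)
qed

lemma differentiable_choice_welfare_component:
  "differentiable_choice_welfare_function (\<lambda>x :: real ^ 'n. ereal (x $ a))"
  unfolding differentiable_choice_welfare_function_def choice_welfare_function_def
  using gderiv_component[of a]
  by (auto simp: less_eq_vec_def gderiv_def differentiable_def)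

lemma choice_prob_pos:
  fixes \<theta> :: "(real ^ 'n) measure"
  assumes "prob_space \<theta>" and sets_eq: "sets \<theta> = sets borel"
  shows "\<exists>\<mu>. choice_prob \<theta> \<mu> $ b > 0"
proof (rule ccontr)
  interpret prob_space \<theta> by fact
  assume "\<not> ?thesis"
  moreover have "0 \<le> choice_prob \<theta> \<mu> $ b" for \<mu>
    by (simp add: choice_prob_nth)
  ultimately have zero: "choice_prob \<theta> \<mu> $ b = 0" for \<mu>
    by (meson antisym not_le)
  define A where "A m = {\<epsilon> \<in> space \<theta>. \<forall>k. k \<noteq> b \<longrightarrow>
    axis b (real m) $ k + \<epsilon> $ k < axis b (real m) $ b + \<epsilon> $ b}" for m
  have "A m \<in> null_sets \<theta>" for m
  proof (rule null_setsI)
    show "A m \<in> sets \<theta>"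
      unfolding A_def by (rule sets_unique_maximiser[OF sets_eq])
    have "measure \<theta> (A m) = 0"
      using zero[of "axis b (real m)"] unfolding A_def choice_prob_nth .
    then show "emeasure \<theta> (A m) = 0"
      by (simp add: emeasure_eq_measure)
  qed
  then have "(\<Union>m. A m) \<in> null_sets \<theta>"
    by (rule null_sets_UN)
  \<comment> \<open>A large deterministic utility of \<open>b\<close> outweighs any given noise vector.\<close>
  moreover have "space \<theta> \<subseteq> (\<Union>m. A m)"
  proof
    fix \<epsilon> assume \<epsilon>: "\<epsilon> \<in> space \<theta>"
    obtain m where m: "(MAX k. \<epsilon> $ k) - \<epsilon> $ b < real m"
      using reals_Archimedean2 by blast
    have "\<epsilon> $ k < real m + \<epsilon> $ b" for k
      using m le_Max_range[of "\<lambda>k. \<epsilon> $ k" k] by linarith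
    then have "\<epsilon> \<in> A m"
      using \<epsilon> by (simp add: A_def axis_def)
    then show "\<epsilon> \<in> (\<Union>m. A m)"
      by blast
  qed
  ultimately have "space \<theta> \<in> null_sets \<theta>"
    using null_sets_subset by blast
  then show False
    using emeasure_space_1 by auto
qed

lemma component_not_random_utility:
  fixes a b :: "'n::finite"
  assumes "a \<noteq> b"
  shows "\<not> (\<exists>\<theta> :: (real ^ 'n) measure. random_utility_model \<theta> \<and>
           has_gradient_field (\<lambda>x. ereal (x $ a)) (choice_prob \<theta>))"
proof
  assume "\<exists>\<theta> :: (real ^ 'n) measure. random_utility_model \<theta> \<and>
            has_gradient_field (\<lambda>x. ereal (x $ a)) (choice_prob \<theta>)"
  then obtain \<theta> :: "(real ^ 'n) measure" where rum: "random_utility_model \<theta>"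
    and grad: "GDERIV (\<lambda>x. x $ a) \<mu> :> choice_prob \<theta> \<mu>" for \<mu>
    by (auto simp: has_gradient_field_def)
  have eq: "choice_prob \<theta> \<mu> = axis a 1" for \<mu>
  proof -
    have "(\<lambda>h. h \<bullet> choice_prob \<theta> \<mu>) = (\<lambda>h. h \<bullet> axis a 1)"
      using has_derivative_unique grad gderiv_component unfolding gderiv_def by blast
    then show ?thesis
      by (metis vector_eq_ldot)
  qed
  obtain \<mu> where "choice_prob \<theta> \<mu> $ b > 0"
    using choice_prob_pos rum unfolding random_utility_model_def by blast
  with eq assms show False
    by (simp add: axis_def)
qed

theorem corollary1:
  shows "(\<forall>\<theta> :: (real ^ 'n) measure.
            random_utility_model \<theta> \<and>
            (\<forall>\<mu> :: real ^ 'n. integrable \<theta> (\<lambda>\<epsilon>. MAX i. \<mu> $ i + \<epsilon> $ i)) \<longrightarrow>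
              differentiable_choice_welfare_function (expected_max_utility \<theta>) \<and>
              has_gradient_field (expected_max_utility \<theta>) (choice_prob \<theta>)) \<and>
         (CARD('n) \<ge> 2 \<longrightarrow>
            (\<exists>w :: real ^ 'n \<Rightarrow> ereal.
               differentiable_choice_welfare_function w \<and>
               \<not> (\<exists>\<theta>. random_utility_model \<theta> \<and> has_gradient_field w (choice_prob \<theta>))))"
proof (intro conjI[of "All _"] allI impI)
  fix \<theta> :: "(real ^ 'n) measure"
  assume "random_utility_model \<theta> \<and>
    (\<forall>\<mu> :: real ^ 'n. integrable \<theta> (\<lambda>\<epsilon>. MAX i. \<mu> $ i + \<epsilon> $ i))"
  then have rum: "random_utility_model \<theta>"
    and int: "integrable \<theta> (\<lambda>\<epsilon>. MAX i. \<mu> $ i + \<epsilon> $ i)" for \<mu> :: "real ^ 'n"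
    by auto
  have "GDERIV (\<lambda>x. real_of_ereal (expected_max_utility \<theta> x)) \<mu> :> choice_prob \<theta> \<mu>" for \<mu>
    using gderiv_expected_max[OF rum int] by (simp add: expected_max_utility_def)
  moreover have "choice_welfare_function (expected_max_utility \<theta>)"
    using choice_welfare_expected_max int rum unfolding random_utility_model_def by blast
  moreover have "\<bar>expected_max_utility \<theta> \<mu>\<bar> \<noteq> \<infinity>" for \<mu>
    by (simp add: expected_max_utility_def)
  ultimately show "differentiable_choice_welfare_function (expected_max_utility \<theta>) \<and>
      has_gradient_field (expected_max_utility \<theta>) (choice_prob \<theta>)"
    unfolding differentiable_choice_welfare_function_def has_gradient_field_def
      gderiv_def differentiable_def by blast
next
  assume "CARD('n) \<ge> 2"
  then obtain a b :: 'n where "a \<noteq> b"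
    by (metis One_nat_def card_le_Suc0_iff_eq finite_class.finite_UNIV not_less_eq_eq
        numeral_2_eq_2)
  then show "\<exists>w :: real ^ 'n \<Rightarrow> ereal. differentiable_choice_welfare_function w \<and>
      \<not> (\<exists>\<theta>. random_utility_model \<theta> \<and> has_gradient_field w (choice_prob \<theta>))"
    using differentiable_choice_welfare_component component_not_random_utility by blast
qed

end
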